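(* Let $n\ge 2$ and fix a density matrix $\beta$ on $\mathbb{C}^n$ all of whose eigenvalues are strictly positive. For a unitary operator $U$ on $\mathbb{C}^n\otimes\mathbb{C}^n$ define the linear map $\Phi_U: M^n\to M^n$ by $\Phi_U(Q)=\mathrm{Tr}_2\big(U\,(Q\otimes\beta)\,U^*\big)$. Then there is an open and dense subset $\mathcal{O}$ of the group of unitary operators on $\mathbb{C}^n\otimes\mathbb{C}^n$ such that for every $U\in\mathcal{O}$ the map $\Phi_U$ has a unique fixed point $Q_{\Phi_U}$ in the set of density matrices, i.e. there is exactly one density matrix $Q$ with $\Phi_U(Q)=Q$.
   Context: $M^n$ denotes the space of $n\times n$ complex matrices. A density matrix is a positive semidefinite self-adjoint matrix of trace $1$. The partial trace $\mathrm{Tr}_2:\mathcal{L}(\mathbb{C}^n\otimes\mathbb{C}^n)\to M^n$ is the linear map determined by $\mathrm{Tr}_2(A\otimes B)=\mathrm{Tr}(B)\,A$. The topology on unitary operators is the usual one (on the matrix coefficients). *)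

theory Defs
  imports "HOL-Analysis.Analysis"
begin

text \<open>Matrices on C^n are represented as complex ^'n ^'n with a finite index type 'n
  (n = CARD('n)); C^n tensor C^n is indexed by the product type 'n \<times> 'n,
  with basis vector e_(i,k) = e_i tensor e_k.\<close>

definition adjoint_mat :: "complex ^'m ^'n \<Rightarrow> complex ^'n ^'m" where
  "adjoint_mat A = (\<chi> i j. cnj (A $ j $ i))"

definition hermitian_mat :: "complex ^'n ^'n \<Rightarrow> bool" where
  "hermitian_mat A \<longleftrightarrow> adjoint_mat A = A"

definition psd_mat :: "complex ^'n ^'n \<Rightarrow> bool" where
  "psd_mat A \<longleftrightarrow> (\<forall>x :: complex ^'n.
      (\<Sum>i\<in>UNIV. cnj (x $ i) * (A *v x) $ i) \<in> \<real> \<and>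
      0 \<le> Re (\<Sum>i\<in>UNIV. cnj (x $ i) * (A *v x) $ i))"

definition trace_mat :: "complex ^'n ^'n \<Rightarrow> complex" where
  "trace_mat A = (\<Sum>i\<in>UNIV. A $ i $ i)"

definition density_mat :: "complex ^'n ^'n \<Rightarrow> bool" where
  "density_mat A \<longleftrightarrow> hermitian_mat A \<and> psd_mat A \<and> trace_mat A = 1"

definition eigenvalue_mat :: "complex ^'n ^'n \<Rightarrow> complex \<Rightarrow> bool" where
  "eigenvalue_mat A c \<longleftrightarrow> (\<exists>v. v \<noteq> 0 \<and> A *v v = c *s v)"

definition unitary_mat :: "complex ^'n ^'n \<Rightarrow> bool" where
  "unitary_mat U \<longleftrightarrow> U ** adjoint_mat U = mat 1 \<and> adjoint_mat U ** U = mat 1"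

definition unitary_group :: "(complex ^'n ^'n) set" where
  "unitary_group = {U. unitary_mat U}"

definition tensor_mat :: "complex ^'n ^'n \<Rightarrow> complex ^'m ^'m \<Rightarrow> complex ^('n \<times> 'm) ^('n \<times> 'm)" where
  "tensor_mat A B = (\<chi> p q. A $ fst p $ fst q * B $ snd p $ snd q)"

text \<open>Partial trace over the second factor: Tr_2(A tensor B) = Tr(B) A.\<close>
definition partial_trace2 :: "complex ^('n::finite \<times> 'm::finite) ^('n \<times> 'm) \<Rightarrow> complex ^'n ^'n" where
  "partial_trace2 M = (\<chi> i j. \<Sum>k\<in>UNIV. M $ (i, k) $ (j, k))"

definition channel_map :: "complex ^('n \<times> 'n) ^('n \<times> 'n) \<Rightarrow> complex ^'n ^'n
    \<Rightarrow> complex ^'n ^'n \<Rightarrow> complex ^'n ^'n" where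
  "channel_map U \<beta> Q = partial_trace2 (U ** tensor_mat Q \<beta> ** adjoint_mat U)"

end

theory Submission
  imports Defs
begin

text \<open>
  For every unitary \<open>U\<close> the channel \<open>\<Phi>\<^sub>U\<close> maps the compact convex set of density matrices to itself, so
  Brouwer's theorem gives a fixed point. It is unique as soon as the linear map
  \<open>L\<^sub>U(Q) = Q - \<Phi>\<^sub>U(Q) + Tr(Q) \<beta>\<close> is injective, since \<open>L\<^sub>U\<close> vanishes on the difference of two fixed points
  of equal trace. The condition \<open>det L\<^sub>U \<noteq> 0\<close> is open. It holds for the swap \<open>S\<close>, for which
  \<open>\<Phi>\<^sub>S(Q) = Tr(Q) \<beta>\<close> and \<open>L\<^sub>S\<close> is the identity. For density, given \<open>U\<close> choose a phase \<open>s\<close> such that \<open>-1\<close>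
  is not an eigenvalue of \<open>W = s U\<^sup>* S\<close>. The unitaries \<open>V(r) = U (W + r) (r W + 1)\<^sup>-\<^sup>1\<close>, with \<open>r\<close> real,
  satisfy \<open>V(0) = s S\<close> and \<open>V(1) = U\<close>. Up to a nonzero factor \<open>det L\<^bsub>V(r)\<^esub>\<close> is a polynomial in \<open>r\<close>, which
  is nonzero at \<open>r = 0\<close>, so \<open>V(r)\<close> is good for all but finitely many \<open>r\<close>, in particular for \<open>r\<close> close to \<open>1\<close>.
\<close>

section \<open>Polynomial functions of a complex variable\<close>

text \<open>Stated for functions rather than for polynomial objects, so that polynomiality of a
  determinant follows by closure rules from its expansion.\<close>

definition polyfun :: "(complex \<Rightarrow> complex) \<Rightarrow> bool" where
  "polyfun f \<longleftrightarrow> (\<exists>p. f = poly p)"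

named_theorems polyfun_intros

lemma polyfun_const [polyfun_intros]: "polyfun (\<lambda>z. c)"
  unfolding polyfun_def by (rule exI[of _ "[:c:]"]) auto

lemma polyfun_ident [polyfun_intros]: "polyfun (\<lambda>z. z)"
  unfolding polyfun_def by (rule exI[of _ "[:0, 1:]"]) auto

lemma polyfun_add [polyfun_intros]:
  assumes "polyfun f" "polyfun g" shows "polyfun (\<lambda>z. f z + g z)"
proof -
  from assms obtain p q where "f = poly p" "g = poly q" unfolding polyfun_def by blast
  then show ?thesis unfolding polyfun_def by (intro exI[of _ "p + q"]) auto
qed

lemma polyfun_mult [polyfun_intros]:
  assumes "polyfun f" "polyfun g" shows "polyfun (\<lambda>z. f z * g z)"
proof -
  from assms obtain p q where "f = poly p" "g = poly q" unfolding polyfun_def by blast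
  then show ?thesis unfolding polyfun_def by (intro exI[of _ "p * q"]) auto
qed

lemma polyfun_diff [polyfun_intros]:
  assumes "polyfun f" "polyfun g" shows "polyfun (\<lambda>z. f z - g z)"
  using polyfun_add[OF assms(1) polyfun_mult[OF polyfun_const[of "-1"] assms(2)]] by simp

lemma polyfun_sum [polyfun_intros]:
  assumes "\<And>i. i \<in> S \<Longrightarrow> polyfun (f i)" shows "polyfun (\<lambda>z. \<Sum>i\<in>S. f i z)"
  using assms by (induction S rule: infinite_finite_induct) (auto intro: polyfun_intros)

lemma polyfun_prod [polyfun_intros]:
  assumes "\<And>i. i \<in> S \<Longrightarrow> polyfun (f i)" shows "polyfun (\<lambda>z. \<Prod>i\<in>S. f i z)"
  using assms by (induction S rule: infinite_finite_induct) (auto intro: polyfun_intros)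

lemma polyfun_if [polyfun_intros]:
  assumes "polyfun f" "polyfun g" shows "polyfun (\<lambda>z. if b then f z else g z)"
  using assms by (cases b) auto

text \<open>Conjugating the coefficients gives the polynomial. At real points it agrees with
  \<open>cnj (f z)\<close>, so adjoints can enter polynomially along a real path.\<close>

lemma polyfun_cnj [polyfun_intros]:
  assumes "polyfun f" shows "polyfun (\<lambda>z. cnj (f (cnj z)))"
proof -
  from assms obtain p where "f = poly p" unfolding polyfun_def by blast
  then show ?thesis unfolding polyfun_def by (intro exI[of _ "map_poly cnj p"]) auto
qed

lemma polyfun_det [polyfun_intros]:
  assumes "\<And>i j. polyfun (\<lambda>z. M z $ i $ j)" shows "polyfun (\<lambda>z. det (M z))"
  unfolding det_def by (intro polyfun_intros assms)

lemma polyfun_imp_continuous_on: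
  assumes "polyfun f" shows "continuous_on S f"
  using assms unfolding polyfun_def by (auto intro!: continuous_intros)

lemma polyfun_finite_zeros:
  assumes "polyfun f" "f a \<noteq> 0" shows "finite {z. f z = 0}"
proof -
  from assms obtain p where "f = poly p" unfolding polyfun_def by blast
  with assms(2) have "p \<noteq> 0" by auto
  then show ?thesis unfolding \<open>f = poly p\<close> by (rule poly_roots_finite)
qed


section \<open>Matrix algebra\<close>

definition cscale_mat :: "complex \<Rightarrow> complex ^'m ^'n \<Rightarrow> complex ^'m ^'n" where
  "cscale_mat c A = (\<chi> i j. c * A $ i $ j)"

lemma cscale_mat_nth [simp]: "cscale_mat c A $ i $ j = c * A $ i $ j"
  by (simp add: cscale_mat_def)

lemma adjoint_mat_nth [simp]: "adjoint_mat A $ i $ j = cnj (A $ j $ i)"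
  by (simp add: adjoint_mat_def)

lemma cscale_mat_mult_left: "cscale_mat c A ** B = cscale_mat c (A ** B)"
  by (simp add: vec_eq_iff matrix_matrix_mult_def sum_distrib_left mult.assoc)

lemma cscale_mat_mult_right: "A ** cscale_mat c B = cscale_mat c (A ** B)"
  by (simp add: vec_eq_iff matrix_matrix_mult_def sum_distrib_left mult.left_commute)

lemma cscale_cscale_mat: "cscale_mat c (cscale_mat d A) = cscale_mat (c * d) A"
  by (simp add: vec_eq_iff mult.assoc)

lemma cscale_mat_one [simp]: "cscale_mat 1 A = A"
  by (simp add: vec_eq_iff)

lemma mat_mult_eq_cscale: "mat c ** A = cscale_mat c A"
  by (simp add: vec_eq_iff matrix_matrix_mult_def mat_def if_distrib if_distribR cong: if_cong)

lemma mult_mat_eq_cscale: "A ** mat c = cscale_mat c A"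
  by (simp add: vec_eq_iff matrix_matrix_mult_def mat_def if_distrib if_distribR mult.commute cong: if_cong)

lemma matrix_add_rdistrib:
  fixes A B :: "complex ^'m ^'n"
  shows "(A + B) ** C = A ** C + B ** C"
  by (simp add: vec_eq_iff matrix_matrix_mult_def distrib_right sum.distrib)

lemma adjoint_mat_mult: "adjoint_mat (A ** B) = adjoint_mat B ** adjoint_mat A"
  by (simp add: vec_eq_iff matrix_matrix_mult_def mult.commute)

lemma adjoint_mat_add: "adjoint_mat (A + B) = adjoint_mat A + adjoint_mat B"
  by (simp add: vec_eq_iff)

lemma adjoint_mat_mat: "adjoint_mat (mat c) = mat (cnj c)"
  by (simp add: vec_eq_iff mat_def)

lemma adjoint_cscale_mat: "adjoint_mat (cscale_mat c A) = cscale_mat (cnj c) (adjoint_mat A)"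
  by (simp add: vec_eq_iff)

lemma adjoint_adjoint_mat [simp]: "adjoint_mat (adjoint_mat A) = A"
  by (simp add: vec_eq_iff)

lemma unitary_matI: "adjoint_mat U ** U = mat 1 \<Longrightarrow> unitary_mat U"
  unfolding unitary_mat_def using matrix_left_right_inverse by blast

lemma unitary_mat_adjoint: "unitary_mat U \<Longrightarrow> unitary_mat (adjoint_mat U)"
  by (simp add: unitary_mat_def)

lemma unitary_mat_mult:
  assumes "unitary_mat U" "unitary_mat V" shows "unitary_mat (U ** V)"
proof (rule unitary_matI)
  have "adjoint_mat (U ** V) ** (U ** V) = adjoint_mat V ** (adjoint_mat U ** U) ** V"
    by (simp add: adjoint_mat_mult matrix_mul_assoc)
  then show "adjoint_mat (U ** V) ** (U ** V) = mat 1"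
    using assms by (simp add: unitary_mat_def)
qed

lemma unitary_cscale_mat:
  assumes "unitary_mat U" "norm c = 1" shows "unitary_mat (cscale_mat c U)"
proof (rule unitary_matI)
  have "cnj c * c = 1"
    using complex_norm_square[of c] assms(2) by (simp add: mult.commute)
  then show "adjoint_mat (cscale_mat c U) ** cscale_mat c U = mat 1"
    using assms(1)
    by (simp add: adjoint_cscale_mat cscale_mat_mult_left cscale_mat_mult_right cscale_cscale_mat
        mult.commute unitary_mat_def)
qed

text \<open>The classical adjugate in Cramer form: column \<open>k\<close> is replaced by the
  \<open>l\<close>-th unit vector. Unlike the inverse, it is polynomial in the entries of
  \<open>A\<close>.\<close>

definition adjugate_mat :: "complex ^'n ^'n \<Rightarrow> complex ^'n ^'n" where
  "adjugate_mat A = (\<chi> k l. det (\<chi> i j. if j = k then axis l 1 $ i else A $ i $ j))"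

text \<open>By Cramer's rule the columns of the scaled adjugate solve
  \<open>A *v x = axis l 1\<close>.\<close>

lemma adjugate_mat_right_inverse:
  fixes A :: "complex ^'n ^'n"
  assumes "det A \<noteq> 0"
  shows "A ** cscale_mat (1 / det A) (adjugate_mat A) = mat 1"
proof -
  have "A *v column l (cscale_mat (1 / det A) (adjugate_mat A)) = axis l 1" for l
    unfolding cramer[OF assms]
    by (simp add: vec_eq_iff column_def adjugate_mat_def)
  moreover have "(A ** X) $ i $ l = (A *v column l X) $ i" for X :: "complex ^'n ^'n" and i l
    by (simp add: matrix_matrix_mult_def matrix_vector_mult_def column_def)
  ultimately show ?thesis by (auto simp add: vec_eq_iff axis_def mat_def)
qed

lemma adjugate_mat_one: "adjugate_mat (mat 1) = mat 1"
  using adjugate_mat_right_inverse[of "mat 1"] by simp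

lemma polyfun_mat [polyfun_intros]:
  assumes "polyfun f" shows "polyfun (\<lambda>z. mat (f z) $ i $ j)"
  unfolding mat_def vec_lambda_beta by (rule polyfun_intros assms)+

lemma polyfun_matrix_mult [polyfun_intros]:
  assumes "\<And>i j. polyfun (\<lambda>z. M z $ i $ j)" "\<And>i j. polyfun (\<lambda>z. N z $ i $ j)"
  shows "polyfun (\<lambda>z. (M z ** N z) $ i $ j)"
  unfolding matrix_matrix_mult_def by (simp, intro polyfun_intros assms)

lemma polyfun_adjugate_mat [polyfun_intros]:
  assumes "\<And>i j. polyfun (\<lambda>z. M z $ i $ j)"
  shows "polyfun (\<lambda>z. adjugate_mat (M z) $ i $ j)"
  unfolding adjugate_mat_def by (simp, intro polyfun_intros, simp, intro polyfun_intros assms)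


section \<open>The defect matrix of a channel\<close>

lemma sum_UNIV_prod: "(\<Sum>p\<in>UNIV. f p) = (\<Sum>a\<in>UNIV. \<Sum>b\<in>UNIV. f (a, b))"
  by (simp add: sum.cartesian_product)

text \<open>Displays the channel as a linear map in the entries of \<open>Q\<close>. The inner
  triple sum is the kernel that reappears in \<open>defect_mat\<close>; the formula also yields
  continuity of the channel.\<close>

lemma channel_map_nth:
  "channel_map U \<beta> Q $ i $ j = (\<Sum>a\<in>UNIV. \<Sum>c\<in>UNIV.
     (\<Sum>k\<in>UNIV. \<Sum>b\<in>UNIV. \<Sum>d\<in>UNIV. U $ (i, k) $ (a, b) * \<beta> $ b $ d * adjoint_mat U $ (c, d) $ (j, k))
     * Q $ a $ c)"
proof -
  have "channel_map U \<beta> Q $ i $ j = (\<Sum>k\<in>UNIV. \<Sum>c\<in>UNIV. \<Sum>d\<in>UNIV. \<Sum>a\<in>UNIV. \<Sum>b\<in>UNIV.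
     U $ (i, k) $ (a, b) * \<beta> $ b $ d * adjoint_mat U $ (c, d) $ (j, k) * Q $ a $ c)"
    by (simp add: channel_map_def partial_trace2_def matrix_matrix_mult_def tensor_mat_def
        sum_UNIV_prod sum_distrib_left sum_distrib_right mult_ac)
  also have "\<dots> = (\<Sum>a\<in>UNIV. \<Sum>c\<in>UNIV. \<Sum>k\<in>UNIV. \<Sum>b\<in>UNIV. \<Sum>d\<in>UNIV.
     U $ (i, k) $ (a, b) * \<beta> $ b $ d * adjoint_mat U $ (c, d) $ (j, k) * Q $ a $ c)"
    unfolding sum.cartesian_product
    by (rule sum.reindex_bij_witness[where
          i = "\<lambda>(a, c, k, b, d). (k, c, d, a, b)" and
          j = "\<lambda>(k, c, d, a, b). (a, c, k, b, d)"]) auto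
  finally show ?thesis
    by (simp add: sum_distrib_right)
qed

text \<open>In the basis of matrix units, \<open>defect_mat \<beta> 1 U (adjoint_mat U)\<close> represents the map
  \<open>Q \<mapsto> Q + Tr(Q) \<beta> - \<Phi>\<^sub>U(Q)\<close>. The extra parameters make it homogeneous, so that common denominators
  of \<open>U\<close> and its adjoint can be cleared.\<close>

definition defect_mat :: "complex ^'n ^'n \<Rightarrow> complex \<Rightarrow> complex ^('n \<times> 'n) ^('n \<times> 'n) \<Rightarrow>
    complex ^('n \<times> 'n) ^('n \<times> 'n) \<Rightarrow> complex ^('n \<times> 'n) ^('n \<times> 'n)" where
  "defect_mat \<beta> c U V = (\<chi> p q.
     c * ((if p = q then 1 else 0) + (if fst q = snd q then \<beta> $ fst p $ snd p else 0)) -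
     (\<Sum>k\<in>UNIV. \<Sum>b\<in>UNIV. \<Sum>d\<in>UNIV. U $ (fst p, k) $ (fst q, b) * \<beta> $ b $ d * V $ (snd q, d) $ (snd p, k)))"

lemma defect_mat_mult_vec:
  "(defect_mat \<beta> 1 U (adjoint_mat U) *v (\<chi> p. Q $ fst p $ snd p)) $ (i, j)
    = Q $ i $ j + trace_mat Q * \<beta> $ i $ j - channel_map U \<beta> Q $ i $ j"
proof -
  have "(\<Sum>a\<in>UNIV. \<Sum>c\<in>UNIV. (if i = a \<and> j = c then 1 else 0) * Q $ a $ c) = Q $ i $ j"
  proof -
    have "(\<Sum>c\<in>UNIV. (if i = a \<and> j = c then 1 else 0) * Q $ a $ c) = (if i = a then Q $ a $ j else 0)" for a
      by (cases "i = a") (simp_all add: if_distrib[of "\<lambda>x. x * _"] cong: if_cong)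
    then show ?thesis by simp
  qed
  moreover have "(\<Sum>a\<in>UNIV. \<Sum>c\<in>UNIV. (if a = c then \<beta> $ i $ j else 0) * Q $ a $ c) = trace_mat Q * \<beta> $ i $ j"
    by (simp add: trace_mat_def if_distrib[of "\<lambda>x. x * _"] sum_distrib_left mult.commute[of _ "\<beta> $ i $ j"] cong: if_cong)
  ultimately show ?thesis
    unfolding matrix_vector_mult_def defect_mat_def sum_UNIV_prod channel_map_nth vec_lambda_beta fst_conv snd_conv
      mult_1_left left_diff_distrib distrib_right sum.distrib sum_subtractf prod.inject
    by simp
qed

text \<open>On a fixed point the defect matrix returns the trace times \<open>\<beta>\<close>. Fixed
  points of equal trace therefore have the same image under an invertible matrix.\<close>

lemma channel_map_fixpoint_unique:
  fixes \<beta> :: "complex ^'n ^'n"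
  assumes "det (defect_mat \<beta> 1 U (adjoint_mat U)) \<noteq> 0"
    and "channel_map U \<beta> Q = Q" "channel_map U \<beta> R = R" "trace_mat Q = trace_mat R"
  shows "Q = R"
proof -
  let ?M = "defect_mat \<beta> 1 U (adjoint_mat U)"
  let ?v = "\<lambda>Q :: complex ^'n ^'n. (\<chi> p. Q $ fst p $ snd p) :: complex ^('n \<times> 'n)"
  have eq: "?M *v ?v Q = ?M *v ?v R"
    unfolding vec_eq_iff using assms(2-4) by (auto simp: defect_mat_mult_vec)
  obtain N where "N ** ?M = mat 1"
    using assms(1) by (metis invertible_det_nz invertible_def)
  then have inv: "N *v (?M *v x) = x" for x
    by (simp add: matrix_vector_mul_assoc)
  have "?v Q = ?v R"
    using arg_cong[OF eq, of "(*v) N"] unfolding inv .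
  then show ?thesis by (simp add: vec_eq_iff)
qed

text \<open>The triple sum is bilinear in \<open>U\<close> and \<open>V\<close>, and the remaining
  terms are linear in the parameter \<open>c * d\<close>.\<close>

lemma defect_mat_cscale:
  "defect_mat \<beta> (c * d) (cscale_mat c U) (cscale_mat d V) = cscale_mat (c * d) (defect_mat \<beta> 1 U V)"
proof -
  have "c * x * y * (d * z) = (c * d) * (x * y * z)" for x y z
    by (simp add: mult_ac)
  then have "(\<Sum>k\<in>UNIV. \<Sum>b\<in>UNIV. \<Sum>e\<in>UNIV. c * U $ (i, k) $ (a, b) * \<beta> $ b $ e * (d * V $ (l, e) $ (j, k)))
    = (c * d) * (\<Sum>k\<in>UNIV. \<Sum>b\<in>UNIV. \<Sum>e\<in>UNIV. U $ (i, k) $ (a, b) * \<beta> $ b $ e * V $ (l, e) $ (j, k))" for i j a l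
    by (simp only: sum_distrib_left)
  then show ?thesis
    unfolding vec_eq_iff defect_mat_def vec_lambda_beta cscale_mat_nth
    by (simp only: right_diff_distrib mult_1_left simp_thms)
qed

section \<open>The swap operator and its defect\<close>

definition swap_mat :: "complex ^('n::finite \<times> 'n) ^('n \<times> 'n)" where
  "swap_mat = (\<chi> p q. if q = (snd p, fst p) then 1 else 0)"

lemma unitary_swap_mat: "unitary_mat swap_mat"
proof (rule unitary_matI)
  have "(\<Sum>r\<in>UNIV. cnj (swap_mat $ r $ p) * swap_mat $ r $ q) = (if p = q then 1 else 0)" for p q :: "'a \<times> 'a"
  proof -
    have "(\<Sum>r\<in>UNIV. cnj (swap_mat $ r $ p) * swap_mat $ r $ q)
      = (\<Sum>r\<in>UNIV. if r = (snd p, fst p) then if p = q then 1 else 0 else 0)"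
      by (rule sum.cong) (auto simp: swap_mat_def)
    then show ?thesis by simp
  qed
  then show "adjoint_mat swap_mat ** swap_mat = (mat 1 :: complex ^('a \<times> 'a) ^('a \<times> 'a))"
    by (simp add: vec_eq_iff matrix_matrix_mult_def mat_def)
qed

text \<open>The swap gives the replacement channel \<open>Q \<mapsto> Tr(Q) \<beta>\<close>, so its defect is the identity.\<close>

lemma defect_swap_mat: "defect_mat \<beta> 1 swap_mat (adjoint_mat swap_mat) = mat 1"
proof -
  have "(\<Sum>k\<in>UNIV. \<Sum>b\<in>UNIV. \<Sum>d\<in>UNIV. swap_mat $ (i, k) $ (a, b) * \<beta> $ b $ d * adjoint_mat swap_mat $ (c, d) $ (j, k))
     = (if a = c then \<beta> $ i $ j else 0)" for i j a c
  proof -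
    have "(\<Sum>b\<in>UNIV. \<Sum>d\<in>UNIV. swap_mat $ (i, k) $ (a, b) * \<beta> $ b $ d * adjoint_mat swap_mat $ (c, d) $ (j, k))
       = (if a = k then if c = k then \<beta> $ i $ j else 0 else 0)" for k
    proof -
      have "(\<Sum>b\<in>UNIV. \<Sum>d\<in>UNIV. swap_mat $ (i, k) $ (a, b) * \<beta> $ b $ d * adjoint_mat swap_mat $ (c, d) $ (j, k))
        = (\<Sum>b\<in>UNIV. \<Sum>d\<in>UNIV. if d = j then if b = i then if a = k \<and> c = k then \<beta> $ b $ d else 0 else 0 else 0)"
        by (intro sum.cong) (auto simp: swap_mat_def)
      then show ?thesis by simp
    qed
    then show ?thesis by simp
  qed
  then show ?thesis
    by (auto simp add: vec_eq_iff defect_mat_def mat_def)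
qed

lemma polyfun_defect_mat [polyfun_intros]:
  assumes "polyfun c" "\<And>i j. polyfun (\<lambda>z. U z $ i $ j)" "\<And>i j. polyfun (\<lambda>z. V z $ i $ j)"
  shows "polyfun (\<lambda>z. defect_mat \<beta> (c z) (U z) (V z) $ i $ j)"
  unfolding defect_mat_def vec_lambda_beta by (rule polyfun_intros assms)+

lemma continuous_on_det_defect_mat:
  "continuous_on S (\<lambda>U. det (defect_mat \<beta> 1 U (adjoint_mat U)))"
  unfolding det_def defect_mat_def adjoint_mat_nth vec_lambda_beta by (rule continuous_intros)+


section \<open>Density along Cayley paths\<close>

text \<open>The determinant is a polynomial in \<open>s\<close> with value 1 at
  \<open>s = 0\<close>, so it has finitely many zeros, whereas the unit circle is infinite.\<close>

lemma ex_unit_det_nz: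
  fixes W :: "complex ^'n ^'n"
  obtains s where "norm s = 1" "det (cscale_mat s W + mat 1) \<noteq> 0"
proof -
  let ?f = "\<lambda>s. det (cscale_mat s W + mat 1)"
  have "polyfun ?f"
    by (rule polyfun_det, unfold vector_add_component cscale_mat_nth) (rule polyfun_intros)+
  moreover have "?f 0 \<noteq> 0"
  proof -
    have "cscale_mat 0 W = 0" by (simp add: vec_eq_iff)
    then show ?thesis by simp
  qed
  ultimately have "finite {s. ?f s = 0}"
    by (rule polyfun_finite_zeros)
  moreover have "infinite (sphere (0::complex) 1)"
  proof
    assume "finite (sphere (0::complex) 1)"
    \<comment> \<open>The circle is connected, and a finite connected set has at most one
      point.\<close>
    then obtain a where "sphere (0::complex) 1 \<subseteq> {a}"
      using connected_finite_iff_sing[of "sphere (0::complex) 1"] connected_sphere[of "0::complex" 1]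
      by fastforce
    moreover have "1 \<in> sphere (0::complex) 1" "-1 \<in> sphere (0::complex) 1" by auto
    ultimately have "1 = a" "-1 = a" by blast+
    then show False by simp
  qed
  ultimately have "\<not> sphere 0 1 \<subseteq> {s. ?f s = 0}"
    using finite_subset by blast
  then obtain s where "s \<in> sphere 0 1" "?f s \<noteq> 0" by blast
  then show ?thesis using that[of s] by simp
qed

text \<open>With \<open>A = W + r\<close> and \<open>B = r W + 1\<close>, unitarity of
  \<open>W\<close> and reality of \<open>r\<close> give equal products \<open>A* A = B* B\<close>.
  Hence \<open>A C\<close> is isometric because \<open>B C = 1\<close> is.\<close>

lemma cayley_unitary:
  fixes r :: real
  assumes "unitary_mat W" "(cscale_mat (of_real r) W + mat 1) ** C = mat 1"
  shows "unitary_mat ((W + mat (of_real r)) ** C)"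
proof (rule unitary_matI)
  let ?A = "W + mat (of_real r)" and ?B = "cscale_mat (of_real r) W + mat 1"
  have W: "adjoint_mat W ** W = mat 1"
    using assms(1) by (simp add: unitary_mat_def)
  have AB: "adjoint_mat ?A ** ?A = adjoint_mat ?B ** ?B"
    by (simp add: adjoint_mat_add adjoint_mat_mat adjoint_cscale_mat matrix_add_ldistrib
        matrix_add_rdistrib mat_mult_eq_cscale mult_mat_eq_cscale cscale_mat_mult_left
        cscale_mat_mult_right cscale_cscale_mat W)
      (simp add: vec_eq_iff mat_def algebra_simps)
  have "adjoint_mat (X ** C) ** (X ** C) = adjoint_mat C ** (adjoint_mat X ** X) ** C" for X
    by (simp add: adjoint_mat_mult matrix_mul_assoc)
  from this[of ?A] this[of ?B] have "adjoint_mat (?A ** C) ** (?A ** C) = adjoint_mat (?B ** C) ** (?B ** C)"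
    unfolding AB by (rule trans[OF _ sym])
  then show "adjoint_mat (?A ** C) ** (?A ** C) = mat 1"
    by (simp add: assms(2) adjoint_mat_mat)
qed

lemma polyfun_tendsto_of_real:
  assumes "polyfun f"
  shows "((\<lambda>r. f (complex_of_real r)) \<longlongrightarrow> f (of_real a)) (at a)"
proof -
  have "isCont f (of_real a)"
    using polyfun_imp_continuous_on[OF assms, of UNIV] by (simp add: continuous_on_eq_continuous_at)
  then show ?thesis
    by (rule isCont_tendsto_compose) (intro tendsto_intros)
qed

lemma det_cscale_mat_eq_0_iff:
  "c \<noteq> 0 \<Longrightarrow> det (cscale_mat c M) = 0 \<longleftrightarrow> det M = 0"
  unfolding mat_mult_eq_cscale[symmetric] det_mul by (simp add: det_diagonal mat_def)

lemma closure_nonsingular_defect: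
  fixes \<beta> :: "complex ^'n ^'n"
  assumes U: "unitary_mat U"
  shows "U \<in> closure {V. unitary_mat V \<and> det (defect_mat \<beta> 1 V (adjoint_mat V)) \<noteq> 0}" (is "_ \<in> closure ?G")
proof -
  \<comment> \<open>The phase makes \<open>W + mat 1\<close>, the denominator of the path at
    parameter 1, invertible.\<close>
  obtain s where s: "norm s = 1" "det (cscale_mat s (adjoint_mat U ** swap_mat) + mat 1) \<noteq> 0"
    by (rule ex_unit_det_nz)
  define W where "W = cscale_mat s (adjoint_mat U ** swap_mat)"
  have W: "unitary_mat W"
    unfolding W_def by (intro unitary_cscale_mat unitary_mat_mult unitary_mat_adjoint U unitary_swap_mat s)
  have UW: "U ** W = cscale_mat s swap_mat"
    using U by (simp add: W_def cscale_mat_mult_right matrix_mul_assoc unitary_mat_def)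
  \<comment> \<open>\<open>B\<close> is the denominator of the Cayley quotient and \<open>d\<close>
    its determinant. Using the adjugate in place of the inverse, \<open>N\<close> is the path
    multiplied by \<open>d\<close>, hence polynomial in \<open>z\<close>.\<close>
  define B where "B z = cscale_mat z W + mat 1" for z
  define d where "d z = det (B z)" for z
  define N where "N z = U ** ((W + mat z) ** adjugate_mat (B z))" for z
  \<comment> \<open>The double conjugations keep \<open>f\<close> polynomial; at real
    \<open>z\<close> they reduce to \<open>cnj (d z)\<close> and the adjoint of \<open>N z\<close>.
    The leading factor \<open>d z\<close> makes \<open>f z \<noteq> 0\<close> also exclude a
    vanishing denominator.\<close>
  define f where "f z = d z * det (defect_mat \<beta> (d z * cnj (d (cnj z))) (N z) (adjoint_mat (N (cnj z))))" for z
  define V where "V r = cscale_mat (1 / d (of_real r)) (N (of_real r))" for r :: real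
  have polyB: "polyfun (\<lambda>z. B z $ i $ j)" for i j
    unfolding B_def vector_add_component cscale_mat_nth by (rule polyfun_intros)+
  have polyd: "polyfun d"
    unfolding d_def by (rule polyfun_det) (rule polyB)
  have polyN: "polyfun (\<lambda>z. N z $ i $ j)" for i j
  proof -
    have "polyfun (\<lambda>z. (W + mat z) $ i $ j)" for i j
      unfolding vector_add_component by (rule polyfun_intros)+
    then show ?thesis
      unfolding N_def by (intro polyfun_matrix_mult polyfun_adjugate_mat polyB polyfun_const)
  qed
  have "polyfun f"
    unfolding f_def
    by (rule polyd polyN polyfun_cnj polyfun_mult polyfun_det polyfun_defect_mat
        | unfold adjoint_mat_nth)+
  moreover have "f 0 \<noteq> 0"
  proof -
    have "B 0 = mat 1" "W + mat 0 = W"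
      by (simp_all add: B_def vec_eq_iff mat_def)
    then have "f 0 = det (defect_mat \<beta> 1 (cscale_mat s swap_mat) (cscale_mat (cnj s) (adjoint_mat swap_mat)))"
      by (simp add: f_def d_def N_def adjugate_mat_one UW adjoint_cscale_mat)
    \<comment> \<open>The phase cancels, so the scaled swap has the same defect as the swap, namely
      the identity.\<close>
    moreover have "s * cnj s = 1"
      using complex_norm_square[of s] s(1) by simp
    ultimately show ?thesis
      using defect_mat_cscale[of \<beta> s "cnj s" swap_mat "adjoint_mat swap_mat"]
      by (simp add: defect_swap_mat)
  qed
  ultimately have "finite {z. f z = 0}"
    by (rule polyfun_finite_zeros)
  then have "finite (complex_of_real -` {z. f z = 0})"
    by (rule finite_vimageI) (simp add: inj_of_real)
  \<comment> \<open>A finite set of real parameters has no limit point, so some punctured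
    neighbourhood of 1 avoids the zeros; \<open>f 1\<close> itself may vanish.\<close>
  then have ev: "eventually (\<lambda>r. f (complex_of_real r) \<noteq> 0) (at 1)"
    using islimpt_finite[of "complex_of_real -` {z. f z = 0}" 1]
    by (simp add: islimpt_iff_eventually)
  have inv: "B z ** cscale_mat (1 / d z) (adjugate_mat (B z)) = mat 1" if "d z \<noteq> 0" for z
    using adjugate_mat_right_inverse[of "B z"] that by (simp add: d_def)
  have V_eq: "V r = U ** ((W + mat (of_real r)) ** cscale_mat (1 / d (of_real r)) (adjugate_mat (B (of_real r))))" for r
    by (simp add: V_def N_def cscale_mat_mult_right)
  have good: "V r \<in> ?G" if "f (of_real r) \<noteq> 0" for r
  proof -
    let ?d = "d (of_real r)"
    have d: "?d \<noteq> 0" using that by (auto simp: f_def)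
    have "unitary_mat (V r)"
      unfolding V_eq using inv[OF d] unfolding B_def
      by (intro unitary_mat_mult U cayley_unitary W) simp
    moreover have "det (defect_mat \<beta> 1 (V r) (adjoint_mat (V r))) \<noteq> 0"
    proof -
      have "N (of_real r) = cscale_mat ?d (V r)"
        using d by (simp add: V_def cscale_cscale_mat)
      then have "defect_mat \<beta> (?d * cnj ?d) (N (of_real r)) (adjoint_mat (N (of_real r)))
         = cscale_mat (?d * cnj ?d) (defect_mat \<beta> 1 (V r) (adjoint_mat (V r)))"
        by (simp add: adjoint_cscale_mat defect_mat_cscale)
      then show ?thesis
        using that d by (simp add: f_def det_cscale_mat_eq_0_iff)
    qed
    ultimately show ?thesis by simp
  qed
  have d1: "d 1 \<noteq> 0"
    using s(2) by (simp add: d_def B_def W_def)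
  \<comment> \<open>At parameter 1 the numerator \<open>W + mat 1\<close> equals \<open>B 1\<close>,
    so the quotient is the identity.\<close>
  have "V 1 = U"
    using inv[OF d1] by (simp add: V_eq B_def)
  moreover have "(V \<longlongrightarrow> V 1) (at 1)"
  proof (intro vec_tendstoI)
    fix i j
    show "((\<lambda>r. V r $ i $ j) \<longlongrightarrow> V 1 $ i $ j) (at 1)"
      unfolding V_def cscale_mat_nth
      using d1 by (intro tendsto_intros polyfun_tendsto_of_real polyd polyN) simp
  qed
  ultimately have "(V \<longlongrightarrow> U) (at 1)" by simp
  moreover have "eventually (\<lambda>r. V r \<in> closure ?G) (at 1)"
    using ev by (rule eventually_mono) (use good closure_subset in blast)
  ultimately show ?thesis
    by (intro Lim_in_closed_set[of "closure ?G" V "at 1"]) auto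
qed


section \<open>Positive semidefinite matrices\<close>

definition qform :: "complex ^'n ^'n \<Rightarrow> complex ^'n \<Rightarrow> complex" where
  "qform A x = (\<Sum>i\<in>UNIV. cnj (x $ i) * (A *v x) $ i)"

text \<open>Membership in the nonnegative reals merges the reality and sign conditions into one that
  is closed under sums.\<close>

lemma psd_mat_iff: "psd_mat A \<longleftrightarrow> (\<forall>x. qform A x \<in> \<real>\<^sub>\<ge>\<^sub>0)"
  unfolding psd_mat_def qform_def by (auto simp: complex_nonneg_Reals_iff complex_is_Real_iff)

lemma sum_nonneg_Reals: "(\<And>i. i \<in> S \<Longrightarrow> f i \<in> \<real>\<^sub>\<ge>\<^sub>0) \<Longrightarrow> sum f S \<in> \<real>\<^sub>\<ge>\<^sub>0"
  by (induction S rule: infinite_finite_induct) auto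

lemma hermitian_mat_nth: "hermitian_mat A \<Longrightarrow> cnj (A $ i $ j) = A $ j $ i"
  by (metis adjoint_mat_nth hermitian_mat_def)

lemma hermitian_mat_iff: "hermitian_mat A \<longleftrightarrow> (\<forall>i j. cnj (A $ i $ j) = A $ j $ i)"
  by (auto simp: hermitian_mat_def vec_eq_iff)

text \<open>Change of the form when one coordinate moves. The entry bounds and the Schur complement
  below come from choices of \<open>x\<close> and \<open>t\<close>.\<close>

lemma qform_add_axis:
  "qform A (x + axis s t) = qform A x + t * (\<Sum>i\<in>UNIV. cnj (x $ i) * A $ i $ s)
     + cnj t * (A *v x) $ s + cnj t * t * A $ s $ s"
proof -
  have axis: "axis s t $ i = (if i = s then t else 0)" for i
    by (simp add: axis_def)
  have "A $ i $ j * (x + axis s t) $ j = A $ i $ j * x $ j + (if j = s then A $ i $ s * t else 0)" for i j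
    by (simp add: axis distrib_left)
  then have "(A *v (x + axis s t)) $ i = (A *v x) $ i + A $ i $ s * t" for i
    by (simp add: matrix_vector_mult_def sum.distrib del: vector_add_component)
  moreover have "cnj ((x + axis s t) $ i) = cnj (x $ i) + (if i = s then cnj t else 0)" for i
    by (simp add: axis)
  ultimately have "qform A (x + axis s t) = (\<Sum>i\<in>UNIV. cnj (x $ i) * (A *v x) $ i + t * (cnj (x $ i) * A $ i $ s)
       + (if i = s then cnj t * ((A *v x) $ s + A $ s $ s * t) else 0))"
    unfolding qform_def by (intro sum.cong) (auto simp: algebra_simps)
  then show ?thesis
    by (simp add: sum.distrib qform_def sum_distrib_left algebra_simps)
qed

lemma qform_axis_add_axis:
  "qform A (axis i 1 + axis s t) = A $ i $ i + t * A $ i $ s + cnj t * A $ s $ i + cnj t * t * A $ s $ s"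
proof -
  have axis: "axis i 1 $ k = (if k = i then 1 else 0 :: complex)" for k
    by (simp add: axis_def)
  have "(A *v axis i 1) $ k = A $ k $ i" for k
    by (simp add: matrix_vector_mult_def axis if_distrib cong: if_cong)
  moreover have "(\<Sum>k\<in>UNIV. cnj (axis i 1 $ k) * f k) = f i" for f :: "_ \<Rightarrow> complex"
    by (simp add: axis if_distrib[of cnj] if_distrib[of "\<lambda>x. x * _"] cong: if_cong)
  ultimately show ?thesis by (simp add: qform_add_axis qform_def[of A "axis i 1"])
qed

lemma psd_mat_diag: "psd_mat A \<Longrightarrow> A $ i $ i \<in> \<real>\<^sub>\<ge>\<^sub>0"
  using qform_axis_add_axis[of A i i 0] by (metis psd_mat_iff add.right_neutral complex_cnj_zero mult_zero_left)

lemma psd_mat_norm_offdiag_le: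
  assumes "psd_mat A" "hermitian_mat A"
  shows "2 * norm (A $ i $ j) \<le> Re (A $ i $ i) + Re (A $ j $ j)"
proof (cases "A $ i $ j = 0")
  case True
  then show ?thesis
    using psd_mat_diag[OF assms(1)] by (simp add: complex_nonneg_Reals_iff)
next
  case False
  define z where "z = A $ i $ j"
  \<comment> \<open>This phase gives \<open>t * z = - norm z\<close>, so both cross terms become as
    negative as possible.\<close>
  define t where "t = - cnj z / of_real (norm z)"
  have z: "norm z \<noteq> 0" using False by (simp add: z_def)
  have zz: "z * cnj z = of_real (norm z) * of_real (norm z)"
    using complex_norm_square[of z] by (simp add: power2_eq_square)
  have "t * z = - of_real (norm z)"
    using z zz by (simp add: t_def field_simps)
  moreover from this have "cnj t * cnj z = - of_real (norm z)"
    by (metis complex_cnj_complex_of_real complex_cnj_minus complex_cnj_mult)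
  moreover have "cnj t * t = 1"
    using z zz by (simp add: t_def)
  moreover have "A $ j $ i = cnj z"
    using hermitian_mat_nth[OF assms(2)] by (simp add: z_def)
  ultimately have "qform A (axis i 1 + axis j t) = A $ i $ i + A $ j $ j - of_real (2 * norm z)"
    by (simp add: qform_axis_add_axis flip: z_def)
  moreover have "qform A (axis i 1 + axis j t) \<in> \<real>\<^sub>\<ge>\<^sub>0"
    using assms(1) by (simp add: psd_mat_iff)
  ultimately show ?thesis
    by (simp add: complex_nonneg_Reals_iff z_def)
qed

text \<open>With a zero diagonal entry the form along \<open>axis s t\<close> has no quadratic term
  in \<open>t\<close>, so a nonzero linear term would make it negative.\<close>

lemma psd_mat_diag_zero:
  assumes "psd_mat A" "hermitian_mat A" "A $ s $ s = 0"
  shows "A $ i $ s = 0"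
proof (rule ccontr)
  define z where "z = A $ i $ s"
  assume "A $ i $ s \<noteq> 0"
  then have z: "z \<noteq> 0" by (simp add: z_def)
  \<comment> \<open>Large enough that the form takes the value \<open>- Re (A $ i $ i) - 2\<close>,
    which is negative.\<close>
  define l where "l = (Re (A $ i $ i) + 1) / (norm z)\<^sup>2"
  have "A $ s $ i = cnj z"
    using hermitian_mat_nth[OF assms(2)] by (simp add: z_def)
  moreover have "z * cnj z = (of_real (norm z))\<^sup>2"
    using complex_norm_square[of z] by simp
  ultimately have "qform A (axis i 1 + axis s (- of_real l * cnj z)) = A $ i $ i - of_real (2 * l * (norm z)\<^sup>2)"
    by (simp add: qform_axis_add_axis assms(3) flip: z_def)
  moreover have "l * (norm z)\<^sup>2 = Re (A $ i $ i) + 1"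
    using z by (simp add: l_def)
  ultimately have "Re (qform A (axis i 1 + axis s (- of_real l * cnj z))) = - Re (A $ i $ i) - 2"
    by simp
  moreover have "qform A (axis i 1 + axis s (- of_real l * cnj z)) \<in> \<real>\<^sub>\<ge>\<^sub>0"
    using assms(1) by (simp add: psd_mat_iff)
  ultimately show False
    using psd_mat_diag[OF assms(1), of i] by (simp add: complex_nonneg_Reals_iff)
qed

text \<open>Completing the square: the form of \<open>B\<close> at \<open>x\<close> is the form of
  \<open>A\<close> at \<open>x\<close> shifted along coordinate \<open>s\<close> by
  \<open>- (q / ?a)\<close>.\<close>

lemma psd_mat_schur_complement:
  assumes "psd_mat A" "hermitian_mat A" "A $ s $ s \<noteq> 0"
  defines "B \<equiv> \<chi> i j. A $ i $ j - A $ i $ s * A $ s $ j / A $ s $ s"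
  shows "psd_mat B"
  unfolding psd_mat_iff
proof
  fix x
  let ?a = "A $ s $ s"
  define q where "q = (A *v x) $ s"
  define p where "p = (\<Sum>i\<in>UNIV. cnj (x $ i) * A $ i $ s)"
  have herm: "cnj (A $ i $ j) = A $ j $ i" for i j
    using assms(2) by (rule hermitian_mat_nth)
  have cq: "cnj q = p"
    by (simp add: q_def p_def matrix_vector_mult_def herm mult.commute)
  have "(B *v x) $ i = (A *v x) $ i - A $ i $ s * (q / ?a)" for i
    by (simp add: B_def q_def matrix_vector_mult_def left_diff_distrib sum_subtractf
        sum_distrib_left sum_divide_distrib mult.assoc)
  then have "qform B x = qform A x - p * (q / ?a)"
    by (simp add: qform_def p_def right_diff_distrib sum_subtractf sum_distrib_right sum_divide_distrib mult.assoc)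
  moreover have "qform A (x + axis s (- (q / ?a))) = qform A x - p * (q / ?a)"
    using assms(3) by (simp add: qform_add_axis herm cq mult.commute[of p] flip: p_def q_def)
  ultimately show "qform B x \<in> \<real>\<^sub>\<ge>\<^sub>0"
    using assms(1) by (metis psd_mat_iff)
qed

text \<open>Induction on a set supporting the entries: subtracting the rank-one matrix built from
  column \<open>s\<close> leaves a Schur complement supported on the smaller set.\<close>

lemma psd_mat_cholesky:
  fixes A :: "complex ^'n ^'n"
  assumes "finite S" "psd_mat A" "hermitian_mat A" "\<And>i j. i \<notin> S \<or> j \<notin> S \<Longrightarrow> A $ i $ j = 0"
  shows "\<exists>V :: 'n \<Rightarrow> complex ^'n. \<forall>i j. A $ i $ j = (\<Sum>m\<in>S. V m $ i * cnj (V m $ j))"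
  using assms
proof (induction S arbitrary: A rule: finite_induct)
  case empty
  then show ?case by simp
next
  case (insert s S)
  note herm = hermitian_mat_nth[OF insert.prems(2)]
  define a where "a = A $ s $ s"
  define B where "B = (\<chi> i j. A $ i $ j - A $ i $ s * A $ s $ j / a)"
  have "\<exists>V :: 'n \<Rightarrow> complex ^'n. \<forall>i j. B $ i $ j = (\<Sum>m\<in>S. V m $ i * cnj (V m $ j))"
  proof (rule insert.IH)
    show "psd_mat B"
    proof (cases "a = 0")
      case True
      \<comment> \<open>Division by zero yields 0, so nothing is subtracted; row and column
        \<open>s\<close> vanish already, as \<open>zero\<close> shows below.\<close>
      then have "B = A" by (simp add: B_def vec_eq_iff)
      then show ?thesis using insert.prems by simp
    next
      case False
      then show ?thesis
        using psd_mat_schur_complement[OF insert.prems(1,2)] by (simp add: B_def a_def)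
    qed
    show "hermitian_mat B"
      by (simp add: hermitian_mat_iff B_def a_def herm mult.commute)
    have zero: "A $ k $ s = 0" "A $ s $ k = 0" if "a = 0" for k
      using psd_mat_diag_zero[OF insert.prems(1,2), of s k] that herm[of k s] by (simp_all add: a_def)
    fix i j assume "i \<notin> S \<or> j \<notin> S"
    then consider "i = s" | "j = s" | "i \<notin> insert s S" | "j \<notin> insert s S" by blast
    then show "B $ i $ j = 0"
    proof cases
      case 1
      then show ?thesis using zero by (cases "a = 0") (simp_all add: B_def flip: a_def)
    next
      case 2
      then show ?thesis using zero by (cases "a = 0") (simp_all add: B_def flip: a_def)
    next
      case 3
      then show ?thesis using insert.prems(3)[of i] by (simp add: B_def)
    next
      case 4
      then show ?thesis using insert.prems(3)[of _ j] by (simp add: B_def)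
    qed
  qed
  then obtain V :: "'n \<Rightarrow> complex ^'n" where V: "\<And>i j. B $ i $ j = (\<Sum>m\<in>S. V m $ i * cnj (V m $ j))"
    by blast
  have a: "a = of_real (Re a)" "0 \<le> Re a"
    using psd_mat_diag[OF insert.prems(1), of s] by (auto simp: a_def complex_nonneg_Reals_iff complex_eq_iff)
  \<comment> \<open>Column \<open>s\<close> normalised by the root of the pivot; for
    \<open>a = 0\<close> it is the zero vector, matching \<open>B = A\<close>.\<close>
  define v where "v = (\<chi> i. A $ i $ s / of_real (sqrt (Re a)))"
  have "v $ i * cnj (v $ j) = A $ i $ s * A $ s $ j / a" for i j
  proof -
    have "v $ i * cnj (v $ j) = A $ i $ s * A $ s $ j / of_real (sqrt (Re a) * sqrt (Re a))"
      by (simp add: v_def herm del: real_sqrt_mult_self real_sqrt_abs2)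
    then show ?thesis using a by simp
  qed
  then have "A $ i $ j = (\<Sum>m\<in>insert s S. (V(s := v)) m $ i * cnj ((V(s := v)) m $ j))" for i j
  proof -
    have "(\<Sum>m\<in>S. (V(s := v)) m $ i * cnj ((V(s := v)) m $ j)) = B $ i $ j"
      unfolding V using insert.hyps by (intro sum.cong) auto
    then show ?thesis
      using insert.hyps \<open>\<And>i j. v $ i * cnj (v $ j) = A $ i $ s * A $ s $ j / a\<close>
      by (simp add: B_def)
  qed
  then show ?case by blast
qed

text \<open>Writing \<open>R\<close> as a sum of rank-one matrices turns the form at
  \<open>y\<close> into a sum of forms of \<open>Q\<close> at the contractions \<open>w m\<close> of
  \<open>y\<close> with \<open>V m\<close>.\<close>

lemma psd_mat_tensor:
  fixes Q :: "complex ^'n ^'n" and R :: "complex ^'m ^'m"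
  assumes "psd_mat Q" "psd_mat R" "hermitian_mat R"
  shows "psd_mat (tensor_mat Q R)"
  unfolding psd_mat_iff
proof
  fix y :: "complex ^('n \<times> 'm)"
  obtain V :: "'m \<Rightarrow> complex ^'m" where V: "\<And>i j. R $ i $ j = (\<Sum>m\<in>UNIV. V m $ i * cnj (V m $ j))"
    using psd_mat_cholesky[of UNIV R] assms by auto
  define w where "w m = (\<chi> c. \<Sum>d\<in>UNIV. cnj (V m $ d) * y $ (c, d))" for m
  have "qform (tensor_mat Q R) y = (\<Sum>a\<in>UNIV. \<Sum>b\<in>UNIV. \<Sum>c\<in>UNIV. \<Sum>d\<in>UNIV. \<Sum>m\<in>UNIV.
      cnj (y $ (a, b)) * Q $ a $ c * (V m $ b * cnj (V m $ d)) * y $ (c, d))"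
    by (simp add: qform_def matrix_vector_mult_def tensor_mat_def sum_UNIV_prod V
        sum_distrib_left sum_distrib_right mult.assoc)
  also have "\<dots> = (\<Sum>m\<in>UNIV. \<Sum>a\<in>UNIV. \<Sum>c\<in>UNIV. \<Sum>b\<in>UNIV. \<Sum>d\<in>UNIV.
      cnj (y $ (a, b)) * Q $ a $ c * (V m $ b * cnj (V m $ d)) * y $ (c, d))"
    unfolding sum.cartesian_product
    by (rule sum.reindex_bij_witness[where
          i = "\<lambda>(m, a, c, b, d). (a, b, c, d, m)" and
          j = "\<lambda>(a, b, c, d, m). (m, a, c, b, d)"]) auto
  also have "\<dots> = (\<Sum>m\<in>UNIV. qform Q (w m))"
  proof -
    have "(\<Sum>b\<in>UNIV. \<Sum>d\<in>UNIV. cnj (y $ (a, b)) * Q $ a $ c * (V m $ b * cnj (V m $ d)) * y $ (c, d))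
       = cnj (w m $ a) * (Q $ a $ c * w m $ c)" for m a c
      by (subst sum.swap) (simp add: w_def sum_product sum_distrib_left mult_ac)
    then show ?thesis
      by (simp add: qform_def matrix_vector_mult_def sum_distrib_left)
  qed
  finally show "qform (tensor_mat Q R) y \<in> \<real>\<^sub>\<ge>\<^sub>0"
    using assms(1) by (auto simp: psd_mat_iff intro!: sum_nonneg_Reals)
qed

section \<open>Positivity under conjugation and partial trace\<close>

lemma sum_cnj_matrix_vector_mult:
  "(\<Sum>i\<in>UNIV. cnj (x $ i) * (U *v y) $ i) = (\<Sum>j\<in>UNIV. cnj ((adjoint_mat U *v x) $ j) * y $ j)"
proof -
  have "(\<Sum>i\<in>UNIV. cnj (x $ i) * (U *v y) $ i) = (\<Sum>i\<in>UNIV. \<Sum>j\<in>UNIV. cnj (x $ i) * U $ i $ j * y $ j)"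
    by (simp add: matrix_vector_mult_def sum_distrib_left mult.assoc)
  also have "\<dots> = (\<Sum>j\<in>UNIV. \<Sum>i\<in>UNIV. cnj (x $ i) * U $ i $ j * y $ j)"
    by (rule sum.swap)
  finally show ?thesis
    by (simp add: matrix_vector_mult_def sum_distrib_left sum_distrib_right mult_ac)
qed

lemma psd_mat_conjugate:
  assumes "psd_mat T" shows "psd_mat (U ** T ** adjoint_mat U)"
proof -
  have "qform (U ** T ** adjoint_mat U) x = qform T (adjoint_mat U *v x)" for x
    unfolding qform_def sum_cnj_matrix_vector_mult[of "adjoint_mat U *v x" T]
    by (simp add: sum_cnj_matrix_vector_mult matrix_vector_mul_assoc[symmetric])
  then show ?thesis
    using assms by (simp add: psd_mat_iff)
qed

lemma psd_mat_partial_trace2: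
  fixes M :: "complex ^('n::finite \<times> 'm::finite) ^('n \<times> 'm)"
  assumes "psd_mat M" shows "psd_mat (partial_trace2 M)"
  unfolding psd_mat_iff
proof
  fix x :: "complex ^'n"
  \<comment> \<open>This is \<open>x\<close> tensored with the \<open>k\<close>-th basis vector;
    summing the form of \<open>M\<close> over these vectors gives the form of the partial trace at
    \<open>x\<close>.\<close>
  define y where "y k = (\<chi> p. if snd p = k then x $ fst p else 0)" for k :: 'm
  have "qform M (y k) = (\<Sum>i\<in>UNIV. \<Sum>j\<in>UNIV. cnj (x $ i) * M $ (i, k) $ (j, k) * x $ j)" for k
  proof -
    have "(M *v y k) $ p = (\<Sum>j\<in>UNIV. M $ p $ (j, k) * x $ j)" for p
      by (simp add: y_def matrix_vector_mult_def sum_UNIV_prod if_distrib cong: if_cong)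
    then show ?thesis
      by (simp add: qform_def y_def sum_UNIV_prod if_distrib[of cnj] if_distrib[of "\<lambda>x. x * _"]
          cong: if_cong) (simp add: sum_distrib_left mult.assoc)
  qed
  then have "(\<Sum>k\<in>UNIV. qform M (y k)) = (\<Sum>k\<in>UNIV. \<Sum>i\<in>UNIV. \<Sum>j\<in>UNIV. cnj (x $ i) * M $ (i, k) $ (j, k) * x $ j)"
    by simp
  also have "\<dots> = (\<Sum>i\<in>UNIV. \<Sum>j\<in>UNIV. \<Sum>k\<in>UNIV. cnj (x $ i) * M $ (i, k) $ (j, k) * x $ j)"
    unfolding sum.cartesian_product
    by (rule sum.reindex_bij_witness[where
          i = "\<lambda>(i, j, k). (k, i, j)" and j = "\<lambda>(k, i, j). (i, j, k)"]) auto
  also have "\<dots> = qform (partial_trace2 M) x"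
    by (simp add: qform_def partial_trace2_def matrix_vector_mult_def sum_distrib_left
        sum_distrib_right mult.assoc)
  finally show "qform (partial_trace2 M) x \<in> \<real>\<^sub>\<ge>\<^sub>0"
    using assms by (metis (no_types, lifting) psd_mat_iff sum_nonneg_Reals)
qed


section \<open>Existence of an invariant density matrix\<close>

lemma trace_mat_mult_commute: "trace_mat (A ** B) = trace_mat (B ** A)"
proof -
  have "trace_mat (A ** B) = (\<Sum>i\<in>UNIV. \<Sum>j\<in>UNIV. A $ i $ j * B $ j $ i)"
    by (simp add: trace_mat_def matrix_matrix_mult_def)
  also have "\<dots> = (\<Sum>j\<in>UNIV. \<Sum>i\<in>UNIV. A $ i $ j * B $ j $ i)"
    by (rule sum.swap)
  finally show ?thesis
    by (simp add: trace_mat_def matrix_matrix_mult_def mult.commute)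
qed

lemma trace_mat_tensor: "trace_mat (tensor_mat A B) = trace_mat A * trace_mat B"
  by (simp add: trace_mat_def tensor_mat_def sum_UNIV_prod sum_product)

lemma trace_mat_partial_trace2: "trace_mat (partial_trace2 M) = trace_mat M"
  by (simp add: trace_mat_def partial_trace2_def sum_UNIV_prod)

lemma density_channel_map:
  assumes U: "unitary_mat U" and Q: "density_mat Q" and \<beta>: "density_mat \<beta>"
  shows "density_mat (channel_map U \<beta> Q)"
  unfolding density_mat_def
proof (intro conjI)
  let ?T = "tensor_mat Q \<beta>"
  note Q = Q[unfolded density_mat_def] and \<beta> = \<beta>[unfolded density_mat_def]
  have "hermitian_mat ?T"
    using Q \<beta> by (simp add: hermitian_mat_iff tensor_mat_def)
  then have "hermitian_mat (U ** ?T ** adjoint_mat U)"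
    by (simp add: hermitian_mat_def adjoint_mat_mult matrix_mul_assoc)
  then show "hermitian_mat (channel_map U \<beta> Q)"
    by (simp add: channel_map_def hermitian_mat_iff partial_trace2_def)
  show "psd_mat (channel_map U \<beta> Q)"
    unfolding channel_map_def using Q \<beta>
    by (intro psd_mat_partial_trace2 psd_mat_conjugate psd_mat_tensor) auto
  have "trace_mat (channel_map U \<beta> Q) = trace_mat (U ** (?T ** adjoint_mat U))"
    by (simp add: channel_map_def trace_mat_partial_trace2 matrix_mul_assoc)
  also have "\<dots> = trace_mat (?T ** (adjoint_mat U ** U))"
    by (subst trace_mat_mult_commute) (simp add: matrix_mul_assoc)
  also have "\<dots> = 1"
    using U Q \<beta> by (simp add: unitary_mat_def trace_mat_tensor)
  finally show "trace_mat (channel_map U \<beta> Q) = 1" .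
qed

section \<open>Convexity and compactness of the set of density matrices\<close>

lemma convex_density_mat: "convex {Q. density_mat Q}"
proof (rule convexI)
  fix Q R :: "complex ^'a ^'a" and u v :: real
  assume "Q \<in> {Q. density_mat Q}" "R \<in> {Q. density_mat Q}" and uv: "0 \<le> u" "0 \<le> v" "u + v = 1"
  then have Q: "hermitian_mat Q" "psd_mat Q" "trace_mat Q = 1"
    and R: "hermitian_mat R" "psd_mat R" "trace_mat R = 1"
    by (auto simp: density_mat_def)
  have nth: "(u *\<^sub>R Q + v *\<^sub>R R) $ i $ j = of_real u * Q $ i $ j + of_real v * R $ i $ j" for i j
    unfolding vector_add_component vector_scaleR_component by (simp add: scaleR_conv_of_real)
  have "qform (u *\<^sub>R Q + v *\<^sub>R R) x = of_real u * qform Q x + of_real v * qform R x" for x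
    unfolding qform_def matrix_vector_mult_def nth
    by (simp add: sum_distrib_left sum.distrib algebra_simps)
  then have "psd_mat (u *\<^sub>R Q + v *\<^sub>R R)"
    using Q(2) R(2) uv by (simp add: psd_mat_iff)
  moreover have "hermitian_mat (u *\<^sub>R Q + v *\<^sub>R R)"
    using Q(1) R(1) by (simp add: hermitian_mat_iff)
  moreover have "trace_mat (u *\<^sub>R Q + v *\<^sub>R R) = of_real u * trace_mat Q + of_real v * trace_mat R"
    unfolding trace_mat_def nth by (simp add: sum.distrib sum_distrib_left)
  ultimately show "u *\<^sub>R Q + v *\<^sub>R R \<in> {Q. density_mat Q}"
    using Q(3) R(3) uv(3) by (simp add: density_mat_def flip: of_real_add)
qed

text \<open>Nonnegative diagonal entries with sum 1 are at most 1, and an off-diagonal entry is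
  bounded by the mean of two of them.\<close>

lemma norm_density_mat_nth_le:
  assumes "density_mat Q" shows "norm (Q $ i $ j) \<le> 1"
proof -
  from assms have Q: "hermitian_mat Q" "psd_mat Q" "trace_mat Q = 1"
    by (auto simp: density_mat_def)
  have nn: "0 \<le> Re (Q $ k $ k)" for k
    using psd_mat_diag[OF Q(2)] by (simp add: complex_nonneg_Reals_iff)
  have "Re (Q $ i $ i) \<le> (\<Sum>k\<in>UNIV. Re (Q $ k $ k))" for i
    by (rule member_le_sum) (auto intro: nn)
  also have "(\<Sum>k\<in>UNIV. Re (Q $ k $ k)) = 1"
    using arg_cong[OF Q(3), of Re] by (simp add: trace_mat_def)
  finally have "Re (Q $ i $ i) \<le> 1" for i .
  from this[of i] this[of j] psd_mat_norm_offdiag_le[OF Q(2,1), of i j] show ?thesis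
    by linarith
qed

lemma compact_density_mat: "compact {Q :: complex ^'n ^'n. density_mat Q}"
  unfolding compact_eq_bounded_closed
proof
  have "norm Q \<le> real CARD('n) * real CARD('n)" if "density_mat Q" for Q :: "complex ^'n ^'n"
  proof -
    have "norm (Q $ i) \<le> real CARD('n)" for i
    proof -
      have "norm (Q $ i) \<le> (\<Sum>j\<in>UNIV. norm (Q $ i $ j))"
        unfolding norm_vec_def by (rule L2_set_le_sum) simp
      also have "\<dots> \<le> (\<Sum>j\<in>(UNIV :: 'n set). 1)"
        by (rule sum_mono) (rule norm_density_mat_nth_le[OF that])
      finally show ?thesis by simp
    qed
    then have "(\<Sum>i\<in>UNIV. norm (Q $ i)) \<le> (\<Sum>i\<in>(UNIV :: 'n set). real CARD('n))"
      by (rule sum_mono)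
    moreover have "norm Q \<le> (\<Sum>i\<in>UNIV. norm (Q $ i))"
      unfolding norm_vec_def[of Q] by (rule L2_set_le_sum) simp
    ultimately show ?thesis by simp
  qed
  then show "bounded {Q :: complex ^'n ^'n. density_mat Q}"
    by (auto simp: bounded_iff)
  have "closed ((\<lambda>Q. qform Q x) -` \<real>\<^sub>\<ge>\<^sub>0)" for x :: "complex ^'n"
    by (rule continuous_closed_vimage) (auto simp: qform_def matrix_vector_mult_def intro!: continuous_intros)
  then have "closed {Q :: complex ^'n ^'n. psd_mat Q}"
    unfolding psd_mat_iff by (intro closed_Collect_all) (simp add: vimage_def)
  moreover have "closed {Q :: complex ^'n ^'n. hermitian_mat Q}"
    unfolding hermitian_mat_iff by (intro closed_Collect_all closed_Collect_eq continuous_intros)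
  moreover have "closed {Q :: complex ^'n ^'n. trace_mat Q = 1}"
    unfolding trace_mat_def by (intro closed_Collect_eq continuous_intros)
  ultimately show "closed {Q :: complex ^'n ^'n. density_mat Q}"
    unfolding density_mat_def by (intro closed_Collect_conj)
qed

lemma ex_density_fixpoint:
  assumes "unitary_mat U" "density_mat \<beta>"
  obtains Q where "density_mat Q" "channel_map U \<beta> Q = Q"
proof -
  have "channel_map U \<beta> = (\<lambda>Q. \<chi> i j. channel_map U \<beta> Q $ i $ j)"
    by (simp add: vec_eq_iff fun_eq_iff)
  moreover have "continuous_on S (\<lambda>Q. \<chi> i j. channel_map U \<beta> Q $ i $ j)" for S
    unfolding channel_map_nth by (rule continuous_intros)+
  ultimately have "continuous_on {Q. density_mat Q} (channel_map U \<beta>)"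
    by metis
  \<comment> \<open>Brouwer's theorem applies; \<open>\<beta>\<close> itself shows that the set is
    nonempty.\<close>
  then obtain Q where "Q \<in> {Q. density_mat Q}" "channel_map U \<beta> Q = Q"
    using brouwer[OF compact_density_mat convex_density_mat] assms density_channel_map[OF assms(1) _ assms(2)]
    by (metis (mono_tags, lifting) Pi_I empty_iff mem_Collect_eq)
  then show thesis using that by simp
qed

theorem theorem1:
  fixes \<beta> :: "complex ^'n ^'n"
  assumes "CARD('n) \<ge> 2"
    and "density_mat \<beta>"
    and "\<And>c. eigenvalue_mat \<beta> c \<Longrightarrow> c \<in> \<real> \<and> 0 < Re c"
  shows "\<exists>\<O>. \<O> \<subseteq> (unitary_group :: (complex ^('n \<times> 'n) ^('n \<times> 'n)) set) \<and>
           openin (top_of_set unitary_group) \<O> \<and>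
           unitary_group \<subseteq> closure \<O> \<and>
           (\<forall>U \<in> \<O>. \<exists>!Q. density_mat Q \<and> channel_map U \<beta> Q = Q)"
proof (intro exI conjI ballI)
  let ?O = "{V. unitary_mat V \<and> det (defect_mat \<beta> 1 V (adjoint_mat V)) \<noteq> 0}"
  show "?O \<subseteq> unitary_group"
    by (auto simp: unitary_group_def)
  have "open {V. det (defect_mat \<beta> 1 V (adjoint_mat V)) \<noteq> 0}"
    by (intro open_Collect_neq continuous_on_det_defect_mat continuous_on_const)
  moreover have "?O = unitary_group \<inter> {V. det (defect_mat \<beta> 1 V (adjoint_mat V)) \<noteq> 0}"
    by (auto simp: unitary_group_def)
  ultimately show "openin (top_of_set unitary_group) ?O"
    by (simp add: openin_open_Int)
  show "unitary_group \<subseteq> closure ?O"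
    using closure_nonsingular_defect by (auto simp: unitary_group_def)
  fix U assume U: "U \<in> ?O"
  then obtain Q where Q: "density_mat Q" "channel_map U \<beta> Q = Q"
    using ex_density_fixpoint assms(2) by blast
  show "\<exists>!Q. density_mat Q \<and> channel_map U \<beta> Q = Q"
  proof (rule ex1I[of _ Q])
    fix R assume "density_mat R \<and> channel_map U \<beta> R = R"
    then show "R = Q"
      using channel_map_fixpoint_unique[of \<beta> U R Q] U Q by (simp add: density_mat_def)
  qed (use Q in simp)
qed

end
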